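(* Let $G$ be an Eulerian graph. Let $\varepsilon(G)$ denote the number of Eulerian orientations of $G$, and let $h(G)$ denote the number of half-graphs of $G$. Then $\varepsilon(G)\geq h(G)$. Equality holds if and only if $G$ is bipartite.
   Context: Graphs are finite. A graph is called Eulerian if all of its degrees are even (connectedness is not required). An Eulerian orientation of an Eulerian graph is an orientation of its edges such that at each vertex the in-degree equals the out-degree. A half-graph of an Eulerian graph $G$ is a spanning subgraph $H$ of $G$ (same vertex set, edge set a subset of $E(G)$) such that $d_H(v)=d_G(v)/2$ for every vertex $v$. *)

theory Defs
  imports Main "HOL-Library.FuncSet"
begin

text \<open>
  Graphs are finite and loopless; parallel edges are allowed. A simple graph is the special case
  in which edges are two-element sets of vertices and \<open>ends\<close> is the identity.
\<close>

record ('v, 'e) ugraph =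
  verts :: "'v set"
  edges :: "'e set"
  ends :: "'e \<Rightarrow> 'v set"

definition wf_ugraph :: "('v, 'e) ugraph \<Rightarrow> bool" where
  "wf_ugraph G \<longleftrightarrow> finite (verts G) \<and> finite (edges G) \<and>
     (\<forall>e \<in> edges G. ends G e \<subseteq> verts G \<and> card (ends G e) = 2)"

definition degree :: "('v, 'e) ugraph \<Rightarrow> 'v \<Rightarrow> nat" where
  "degree G v = card {e \<in> edges G. v \<in> ends G e}"

definition eulerian :: "('v, 'e) ugraph \<Rightarrow> bool" where
  "eulerian G \<longleftrightarrow> wf_ugraph G \<and> (\<forall>v \<in> verts G. even (degree G v))"

text \<open>
  An orientation assigns to every edge a pair (tail, head) consisting of its two endpoints.
  The extensional function space makes values outside the edge set irrelevant for counting.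
\<close>

definition orientations :: "('v, 'e) ugraph \<Rightarrow> ('e \<Rightarrow> 'v \<times> 'v) set" where
  "orientations G = (\<Pi>\<^sub>E e \<in> edges G. {(u, v). ends G e = {u, v}})"

definition in_degree :: "('v, 'e) ugraph \<Rightarrow> ('e \<Rightarrow> 'v \<times> 'v) \<Rightarrow> 'v \<Rightarrow> nat" where
  "in_degree G d v = card {e \<in> edges G. snd (d e) = v}"

definition out_degree :: "('v, 'e) ugraph \<Rightarrow> ('e \<Rightarrow> 'v \<times> 'v) \<Rightarrow> 'v \<Rightarrow> nat" where
  "out_degree G d v = card {e \<in> edges G. fst (d e) = v}"

definition eulerian_orientations :: "('v, 'e) ugraph \<Rightarrow> ('e \<Rightarrow> 'v \<times> 'v) set" where
  "eulerian_orientations G =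
     {d \<in> orientations G. \<forall>v \<in> verts G. in_degree G d v = out_degree G d v}"

text \<open>
  Requiring the total function \<open>ends\<close> to agree, also outside the edge set, makes a spanning
  subgraph determined by its edge set, so that counting spanning subgraphs is meaningful.
\<close>

definition spanning_subgraph :: "('v, 'e) ugraph \<Rightarrow> ('v, 'e) ugraph \<Rightarrow> bool" where
  "spanning_subgraph H G \<longleftrightarrow> verts H = verts G \<and> edges H \<subseteq> edges G \<and> ends H = ends G"

definition half_graphs :: "('v, 'e) ugraph \<Rightarrow> ('v, 'e) ugraph set" where
  "half_graphs G =
     {H. spanning_subgraph H G \<and> (\<forall>v \<in> verts G. 2 * degree H v = degree G v)}"

definition bipartite :: "('v, 'e) ugraph \<Rightarrow> bool" where
  "bipartite G \<longleftrightarrow> (\<exists>A B. A \<union> B = verts G \<and> A \<inter> B = {} \<and>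
     (\<forall>e \<in> edges G. \<exists>a \<in> A. \<exists>b \<in> B. ends G e = {a, b}))"

end

theory Submission
  imports "HOL-Computational_Algebra.Polynomial" Defs
begin

text \<open>
  Let every vertex choose half of its incident edges. A half-graph is a family of choices in which
  the two ends of every edge agree, an Eulerian orientation one in which they disagree. Writing the
  edge constraints as \<open>(1 \<plusminus> \<chi>\<^sub>e) / 2\<close> with \<open>\<chi>\<^sub>e = \<plusminus>1\<close> and expanding gives, with \<open>m\<close> the number of edges,
  \<open>2\<^sup>m h(G) = \<Sum>\<^sub>A W(A)\<close> and \<open>2\<^sup>m \<epsilon>(G) = \<Sum>\<^sub>A (-1)\<^bsup>|A|\<^esup> W(A)\<close> over all edge sets \<open>A\<close>, where \<open>W(A)\<close> is a
  product over the vertices \<open>v\<close> of middle Krawtchouk values at the degree \<open>d\<^sub>A(v)\<close>. Such a value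
  vanishes if \<open>d\<^sub>A(v)\<close> is odd and has sign \<open>(-1)\<^bsup>d\<^sub>A(v)/2\<^esup>\<close> otherwise, and the halved degrees add up
  to \<open>|A|\<close>, so \<open>(-1)\<^bsup>|A|\<^esup> W(A) = |W(A)|\<close>. Hence \<open>\<epsilon>(G) - h(G)\<close> is a positive combination over the edge
  sets of odd size with all degrees even, and such sets exist exactly when \<open>G\<close> is not bipartite.
\<close>

section \<open>Balanced character sums\<close>

text \<open>For finite \<open>D\<close> of size \<open>2 * k\<close> this is the binary Krawtchouk
  polynomial of degree \<open>k\<close> evaluated at \<open>card (D \<inter> T)\<close>. For odd
  \<open>card D\<close> the sum is empty.\<close>

definition char_sum :: "'a set \<Rightarrow> 'a set \<Rightarrow> real" where
  "char_sum D T = (\<Sum>S | S \<subseteq> D \<and> 2 * card S = card D. (-1) ^ card (S \<inter> T))"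

text \<open>Complementation inside \<open>D\<close> preserves the half-size condition and flips the
  sign of every term, because the two pieces of \<open>D \<inter> T\<close> have odd total
  size.\<close>

lemma char_sum_odd:
  assumes "finite D" and "odd (card (D \<inter> T))"
  shows "char_sum D T = 0"
proof -
  have "char_sum D T = (\<Sum>S | S \<subseteq> D \<and> 2 * card S = card D. (-1) ^ card ((D - S) \<inter> T))"
    unfolding char_sum_def
    by (rule sum.reindex_bij_witness[of _ "\<lambda>S. D - S" "\<lambda>S. D - S"])
      (use assms in \<open>auto simp: card_Diff_subset finite_subset double_diff\<close>)
  also have "\<dots> = (\<Sum>S | S \<subseteq> D \<and> 2 * card S = card D. - ((-1) ^ card (S \<inter> T)))"
  proof (rule sum.cong)
    fix S assume "S \<in> {S. S \<subseteq> D \<and> 2 * card S = card D}"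
    then have "D \<inter> T = (S \<inter> T) \<union> ((D - S) \<inter> T)" and "finite S"
      using assms(1) finite_subset by auto
    then have "card (D \<inter> T) = card (S \<inter> T) + card ((D - S) \<inter> T)"
      using assms(1) by (auto intro!: card_Un_disjoint)
    with assms(2) show "(-1) ^ card ((D - S) \<inter> T) = - ((-1) ^ card (S \<inter> T) :: real)"
      by (cases "even (card (S \<inter> T))") auto
  qed simp
  also have "\<dots> = - char_sum D T"
    unfolding char_sum_def by (rule sum_negf)
  finally show ?thesis by simp
qed

text \<open>Generating function: each element of \<open>D\<close> contributes a factor 1 - x or 1 +
  x according to membership in \<open>T\<close>, and the coefficient of x^k collects the subsets of
  size \<open>k\<close>.\<close>

lemma char_sum_eq_coeff:
  assumes "finite D" and "card D = 2 * k"
  shows "char_sum D T =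
    coeff ([:1, -1:] ^ card (D \<inter> T) * [:1, 1:] ^ card (D - T)) k"
proof -
  define s :: "'a \<Rightarrow> real" where "s x = (if x \<in> T then -1 else 1)" for x
  have s_prod: "(\<Prod>x\<in>S. s x) = (-1) ^ card (S \<inter> T)" if "S \<subseteq> D" for S
    using finite_subset[OF that assms(1)]
    by (simp add: s_def prod.If_cases Int_def)
  have "([:1, -1:] ^ card (D \<inter> T) * [:1, 1:] ^ card (D - T) :: real poly)
      = (\<Prod>x\<in>D. if x \<in> T then [:1, -1:] else [:1, 1:])"
    using assms(1) by (simp add: prod.If_cases Int_def Diff_eq)
  also have "\<dots> = (\<Prod>x\<in>D. monom (s x) 1 + 1)"
    by (rule prod.cong) (auto simp: s_def monom_altdef one_pCons)
  also have "\<dots> = (\<Sum>S\<in>Pow D. \<Prod>x\<in>S. monom (s x) 1)"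
    by (subst prod_add) (use assms in auto)
  also have "\<dots> = (\<Sum>S\<in>Pow D. monom ((-1) ^ card (S \<inter> T)) (card S))"
  proof (rule sum.cong)
    fix S assume "S \<in> Pow D"
    then have "finite S" using assms(1) finite_subset by auto
    then have "(\<Prod>x\<in>S. monom (s x) 1) = monom (\<Prod>x\<in>S. s x) (card S)"
      by (induction) (auto simp: mult_monom)
    then show "(\<Prod>x\<in>S. monom (s x) 1) = monom ((-1) ^ card (S \<inter> T)) (card S)"
      using \<open>S \<in> Pow D\<close> by (simp add: s_prod)
  qed simp
  finally have "coeff ([:1, -1:] ^ card (D \<inter> T) * [:1, 1:] ^ card (D - T)) k
      = (\<Sum>S\<in>Pow D. if card S = k then (-1) ^ card (S \<inter> T) else (0::real))"
    by (simp add: coeff_sum)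
  also have "\<dots> = char_sum D T"
    unfolding char_sum_def using assms
    by (intro sum.mono_neutral_cong_right) auto
  finally show ?thesis ..
qed

text \<open>The absolute values are the super Catalan numbers; the recurrence comes from
  \<open>(1 + x)\<^sup>2 - (1 - x)\<^sup>2 = 4 x\<close>.\<close>

lemma coeff_balanced:
  "coeff ([:1, -1:] ^ (2 * j) * [:1, 1:] ^ (2 * m)) (j + m)
    = (-1) ^ j * (fact (2 * j) * fact (2 * m) / (fact j * fact m * fact (j + m)) :: real)"
proof (induction j arbitrary: m)
  case 0
  have "coeff ([:1, 1:] ^ (2 * m)) m = real (2 * m choose m)"
    by (subst coeff_linear_poly_power) auto
  also have "\<dots> = fact (2 * m) / (fact m * fact m)"
    by (subst binomial_fact) (auto simp: mult_2)
  finally show ?case by simp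
next
  case (Suc j)
  let ?p = "[:1, -1:] :: real poly" and ?q = "[:1, 1:] :: real poly"
  have "?p ^ 2 = ?q ^ 2 - monom 4 1"
    by (simp add: power2_eq_square monom_altdef)
  then have "?p ^ (2 * Suc j) * ?q ^ (2 * m)
      = ?p ^ (2 * j) * ?q ^ (2 * Suc m) - monom 4 1 * (?p ^ (2 * j) * ?q ^ (2 * m))"
    unfolding mult_Suc_right power_add by (simp only: left_diff_distrib right_diff_distrib mult_ac)
  then have "coeff (?p ^ (2 * Suc j) * ?q ^ (2 * m)) (Suc j + m)
      = coeff (?p ^ (2 * j) * ?q ^ (2 * Suc m)) (j + Suc m)
        - 4 * coeff (?p ^ (2 * j) * ?q ^ (2 * m)) (j + m)"
    by (simp add: coeff_monom_mult)
  \<comment> \<open>The induction hypothesis is used at \<open>Suc m\<close> and at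
    \<open>m\<close>; the quotient of the two factorial expressions is
    \<open>2 * (2 * m + 1) / (j + m + 1)\<close>.\<close>
  also have "\<dots> = (-1) ^ j * (fact (2 * j) * fact (2 * m) / (fact j * fact m * fact (j + m)))
      * (2 * (2 * m + 1) / (j + m + 1) - 4)"
    unfolding Suc.IH by (simp add: divide_simps) (simp add: algebra_simps)
  also have "2 * (2 * m + 1) / (j + m + 1) - 4 = - (2 * (2 * j + 1) / (real j + m + 1))"
    by (simp add: field_simps)
  also have "(-1) ^ j * (fact (2 * j) * fact (2 * m) / (fact j * fact m * fact (j + m))) * \<dots>
      = (-1) ^ Suc j * (fact (2 * Suc j) * fact (2 * m)
          / (fact (Suc j) * fact m * fact (Suc j + m)) :: real)"
    by (simp add: divide_simps) (simp add: algebra_simps)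
  finally show ?case .
qed

text \<open>Both \<open>D \<inter> T\<close> and \<open>D - T\<close> have even size, so
  \<open>coeff_balanced\<close> applies; its only sign is \<open>(-1) ^ j\<close> with
  \<open>j\<close> half of \<open>card (D \<inter> T)\<close>.\<close>

lemma char_sum_even:
  assumes "finite D" and "even (card D)" and "even (card (D \<inter> T))"
  shows "(-1) ^ (card (D \<inter> T) div 2) * char_sum D T > 0"
proof -
  obtain j where j: "card (D \<inter> T) = 2 * j" using assms(3) by auto
  have "card D = card (D \<inter> T) + card (D - T)"
    using assms(1) by (metis card_Int_Diff)
  then obtain m where m: "card (D - T) = 2 * m" and D: "card D = 2 * (j + m)"
    using j assms(2) by (metis dvd_add_right_iff distrib_left dvdE dvd_triv_left)
  have "char_sum D T = coeff ([:1, -1:] ^ (2 * j) * [:1, 1:] ^ (2 * m)) (j + m)"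
    using char_sum_eq_coeff[OF assms(1) D] j m by simp
  then show ?thesis
    unfolding coeff_balanced by (simp add: j flip: power_mult_distrib mult.assoc power_add)
qed

section \<open>Parity criterion for bipartiteness\<close>

lemma odd_card_sym_diff:
  assumes "finite A" "finite B"
  shows "odd (card ((A - B) \<union> (B - A))) \<longleftrightarrow> odd (card A) \<noteq> odd (card B)"
proof -
  have "card ((A - B) \<union> (B - A)) = card (A - B) + card (B - A)"
    using assms by (intro card_Un_disjoint) auto
  moreover have "card A = card (A \<inter> B) + card (A - B)" "card B = card (A \<inter> B) + card (B - A)"
    using assms by (metis card_Int_Diff, metis card_Int_Diff Int_commute)
  ultimately show ?thesis by presburger
qed

definition incident :: "('v, 'e) ugraph \<Rightarrow> 'v \<Rightarrow> 'e set" where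
  "incident G v = {e \<in> edges G. v \<in> ends G e}"

text \<open>Edge sets with boundary \<open>{u, v}\<close> replace walks from \<open>u\<close> to \<open>v\<close>: symmetric difference plays the
  role of concatenation. The flag \<open>b\<close> records the parity of the number of edges.\<close>

definition joins :: "('v, 'e) ugraph \<Rightarrow> 'v \<Rightarrow> 'v \<Rightarrow> bool \<Rightarrow> bool" where
  "joins G u v b \<longleftrightarrow> (\<exists>A \<subseteq> edges G. odd (card A) = b \<and>
     (\<forall>w \<in> verts G. odd (card (incident G w \<inter> A)) \<longleftrightarrow> (w = u) \<noteq> (w = v)))"

lemma joins_refl: "joins G u u False"
  unfolding joins_def by (rule exI[of _ "{}"]) auto

lemma joins_sym: "joins G u v b \<Longrightarrow> joins G v u b"
  unfolding joins_def by metis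

text \<open>Size and vertex degrees modulo 2 are additive under symmetric difference, so the middle
  vertex cancels from the boundary and the flags combine by exclusive or.\<close>

lemma joins_trans:
  assumes "wf_ugraph G" "joins G u v b" "joins G v w c"
  shows "joins G u w (b \<noteq> c)"
proof -
  obtain A where A: "A \<subseteq> edges G" "odd (card A) = b"
    "\<forall>x \<in> verts G. odd (card (incident G x \<inter> A)) \<longleftrightarrow> (x = u) \<noteq> (x = v)"
    using assms(2) unfolding joins_def by blast
  obtain B where B: "B \<subseteq> edges G" "odd (card B) = c"
    "\<forall>x \<in> verts G. odd (card (incident G x \<inter> B)) \<longleftrightarrow> (x = v) \<noteq> (x = w)"
    using assms(3) unfolding joins_def by blast
  have fin: "finite A" "finite B"
    using A(1) B(1) assms(1) finite_subset unfolding wf_ugraph_def by auto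
  have "incident G x \<inter> ((A - B) \<union> (B - A))
      = ((incident G x \<inter> A) - (incident G x \<inter> B)) \<union> ((incident G x \<inter> B) - (incident G x \<inter> A))" for x
    by auto
  then have "odd (card (incident G x \<inter> ((A - B) \<union> (B - A))))
      \<longleftrightarrow> odd (card (incident G x \<inter> A)) \<noteq> odd (card (incident G x \<inter> B))" for x
    using odd_card_sym_diff fin by (metis finite_Int)
  then show ?thesis
    unfolding joins_def using A B odd_card_sym_diff[OF fin]
    by (intro exI[of _ "(A - B) \<union> (B - A)"]) auto
qed

lemma wf_ends:
  assumes "wf_ugraph G" "e \<in> edges G"
  obtains u v where "ends G e = {u, v}" "u \<noteq> v" "u \<in> verts G" "v \<in> verts G"
  using assms unfolding wf_ugraph_def by (auto simp: card_2_iff)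

lemma joins_edge:
  assumes "e \<in> edges G" "ends G e = {u, v}" "u \<noteq> v"
  shows "joins G u v True"
  unfolding joins_def
proof (intro exI[of _ "{e}"] conjI ballI)
  fix w
  have "incident G w \<inter> {e} = (if w \<in> {u, v} then {e} else {})"
    using assms unfolding incident_def by auto
  then show "odd (card (incident G w \<inter> {e})) \<longleftrightarrow> (w = u) \<noteq> (w = v)"
    using assms(3) by auto
qed (use assms in auto)

text \<open>Double counting of incidences. It serves once with \<open>U\<close> a colour class,
  where each edge counts 1, and once with \<open>U\<close> all vertices, where each edge counts
  2.\<close>

lemma sum_card_incident:
  assumes "wf_ugraph G" "A \<subseteq> edges G" "U \<subseteq> verts G"
  shows "(\<Sum>v\<in>U. card (incident G v \<inter> A)) = (\<Sum>e\<in>A. card (ends G e \<inter> U))"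
proof -
  have fin: "finite U" "finite A"
    using assms finite_subset unfolding wf_ugraph_def by auto
  have "(\<Sum>v\<in>U. card (incident G v \<inter> A)) = (\<Sum>v\<in>U. \<Sum>e\<in>A. of_bool (v \<in> ends G e))"
  proof (rule sum.cong)
    fix v
    have "incident G v \<inter> A = {e \<in> A. v \<in> ends G e}"
      using assms(2) unfolding incident_def by auto
    then show "card (incident G v \<inter> A) = (\<Sum>e\<in>A. of_bool (v \<in> ends G e))"
      using fin by (simp add: Int_def)
  qed simp
  also have "\<dots> = (\<Sum>e\<in>A. \<Sum>v\<in>U. of_bool (v \<in> ends G e))"
    by (rule sum.swap)
  also have "\<dots> = (\<Sum>e\<in>A. card (ends G e \<inter> U))"
    using fin by (intro sum.cong) (auto simp: Int_def conj_commute)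
  finally show ?thesis .
qed

text \<open>In a bipartite graph each edge has one end in a fixed class, so \<open>card A\<close> is
  a sum of even degrees. Conversely, if no odd set has all degrees even, the parity of an edge set
  joining two vertices is unique, and parity from a component representative is a
  2-colouring.\<close>

lemma bipartite_iff_no_odd_even_subgraph:
  assumes "wf_ugraph G"
  shows "bipartite G \<longleftrightarrow>
    (\<forall>A \<subseteq> edges G. (\<forall>v \<in> verts G. even (card (incident G v \<inter> A))) \<longrightarrow> even (card A))"
proof
  assume "bipartite G"
  obtain U W where UW: "U \<union> W = verts G" "U \<inter> W = {}"
    "\<forall>e \<in> edges G. \<exists>a \<in> U. \<exists>b \<in> W. ends G e = {a, b}"
    using \<open>bipartite G\<close>[unfolded bipartite_def] by metis
  then have U: "U \<subseteq> verts G" by blast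
  show "\<forall>A \<subseteq> edges G. (\<forall>v \<in> verts G. even (card (incident G v \<inter> A))) \<longrightarrow> even (card A)"
  proof (intro allI impI)
    fix A assume A: "A \<subseteq> edges G" and even: "\<forall>v \<in> verts G. even (card (incident G v \<inter> A))"
    have "card (ends G e \<inter> U) = 1" if "e \<in> A" for e
    proof -
      obtain a b where "a \<in> U" "b \<in> W" "ends G e = {a, b}"
        using bspec[OF UW(3) subsetD[OF A \<open>e \<in> A\<close>]] by blast
      moreover from this have "b \<notin> U" using UW(2) by blast
      ultimately show ?thesis by simp
    qed
    then have "card A = (\<Sum>v\<in>U. card (incident G v \<inter> A))"
      by (subst sum_card_incident[OF assms A U]) simp
    also have "even \<dots>"
      by (rule dvd_sum) (use even U in blast)
    finally show "even (card A)" .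
  qed
next
  assume even: "\<forall>A \<subseteq> edges G.
    (\<forall>v \<in> verts G. even (card (incident G v \<inter> A))) \<longrightarrow> even (card A)"
  \<comment> \<open>For equal end points the boundary is empty, so this would be an odd set with all
    degrees even.\<close>
  have no_odd: "\<not> joins G v v True" for v
    using even unfolding joins_def by (metis (full_types))
  \<comment> \<open>The choice depends only on the set of vertices joined to \<open>u\<close>, hence
    adjacent vertices get the same representative.\<close>
  define rep where "rep u = (SOME w. \<exists>b. joins G u w b)" for u
  define W where "W = {v \<in> verts G. joins G (rep v) v True}"
  have rep: "\<exists>b. joins G (rep v) v b" for v
  proof -
    have "\<exists>b. joins G v (rep v) b"
      unfolding rep_def by (rule someI[of _ v]) (rule exI, rule joins_refl)
    then show ?thesis by (auto intro: joins_sym)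
  qed
  have "\<exists>a \<in> verts G - W. \<exists>b \<in> W. ends G e = {a, b}" if e: "e \<in> edges G" for e
  proof -
    obtain u v where uv: "ends G e = {u, v}" "u \<noteq> v" "u \<in> verts G" "v \<in> verts G"
      by (rule wf_ends[OF assms e])
    have j: "joins G u v True" by (rule joins_edge[OF e uv(1,2)])
    have "(\<exists>b. joins G u w b) \<longleftrightarrow> (\<exists>b. joins G v w b)" for w
    proof (rule iffI; elim exE)
      show "\<exists>b. joins G v w b" if "joins G u w b" for b
        by (rule exI, rule joins_trans[OF assms joins_sym[OF j] that])
      show "\<exists>b. joins G u w b" if "joins G v w b" for b
        by (rule exI, rule joins_trans[OF assms j that])
    qed
    then have r: "rep u = rep v" unfolding rep_def by simp
    have "joins G (rep v) v True \<noteq> joins G (rep u) u True"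
    proof -
      obtain b where b: "joins G (rep v) u b" using rep[of u] r by auto
      then have b': "joins G (rep v) v (\<not> b)" using joins_trans[OF assms b j] by simp
      \<comment> \<open>Joining sets of different parity would combine to an odd set with empty
        boundary, against \<open>no_odd\<close>.\<close>
      have unique: "c = d" if "joins G (rep v) x c" "joins G (rep v) x d" for x c d
        using joins_trans[OF assms that(1) joins_sym[OF that(2)]] no_odd by (cases "c = d") auto
      show ?thesis
        using unique[OF b] unique[OF b'] b b' r by (cases b) auto
    qed
    then have "u \<in> verts G - W \<and> v \<in> W \<or> v \<in> verts G - W \<and> u \<in> W"
      using uv(3,4) unfolding W_def by auto
    then show ?thesis using uv(1) insert_commute[of u v "{}"] by metis
  qed
  then show "bipartite G"
    unfolding bipartite_def
    by (intro exI[of _ "verts G - W"] exI[of _ W] conjI) (auto simp: W_def simp del: bex_simps)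
qed

section \<open>Half-graphs and orientations as local choices\<close>

text \<open>The choices at different vertices are independent; as an extensional product, this set
  lets sums over it factor into products over the vertices.\<close>

definition half_choices :: "('v, 'e) ugraph \<Rightarrow> ('v \<Rightarrow> 'e set) set" where
  "half_choices G =
     (\<Pi>\<^sub>E v \<in> verts G. {S. S \<subseteq> incident G v \<and> 2 * card S = card (incident G v)})"

text \<open>Being a product over the ends, this sign can be regrouped by vertices when multiplied
  over a set of edges.\<close>

definition edge_sign :: "('v, 'e) ugraph \<Rightarrow> ('v \<Rightarrow> 'e set) \<Rightarrow> 'e \<Rightarrow> real" where
  "edge_sign G F e = (\<Prod>v\<in>ends G e. if e \<in> F v then -1 else 1)"

lemma edge_sign_doubleton:
  "ends G e = {u, v} \<Longrightarrow> u \<noteq> v \<Longrightarrow>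
    edge_sign G F e = (if e \<in> F u \<longleftrightarrow> e \<in> F v then 1 else -1)"
  unfolding edge_sign_def by auto

lemma finite_incident: "wf_ugraph G \<Longrightarrow> finite (incident G v)"
  unfolding wf_ugraph_def incident_def by auto

lemma finite_half_choices:
  assumes "wf_ugraph G"
  shows "finite (half_choices G)"
proof -
  have "finite (verts G)" using assms unfolding wf_ugraph_def by auto
  moreover have "finite {S. S \<subseteq> incident G v \<and> 2 * card S = card (incident G v)}" for v
    using finite_incident[OF assms] by auto
  ultimately show ?thesis
    unfolding half_choices_def by (intro finite_PiE)
qed

lemma half_choices_D:
  assumes "F \<in> half_choices G"
  shows "v \<in> verts G \<Longrightarrow> F v \<subseteq> incident G v"
    and "v \<in> verts G \<Longrightarrow> 2 * card (F v) = card (incident G v)"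
    and "v \<notin> verts G \<Longrightarrow> F v = undefined"
  using PiE_mem[OF assms[unfolded half_choices_def], of v]
    PiE_arb[OF assms[unfolded half_choices_def], of v] by simp_all

lemma half_graph_iff:
  "H \<in> half_graphs G \<longleftrightarrow> verts H = verts G \<and> edges H \<subseteq> edges G \<and> ends H = ends G \<and>
    (\<forall>v \<in> verts G. 2 * card (incident H v) = card (incident G v))"
  unfolding half_graphs_def spanning_subgraph_def Defs.degree_def incident_def by simp

text \<open>A half-graph is read as the family of its edge sets at the vertices. A family of choices
  glues to one edge set exactly when the two ends of every edge agree.\<close>

lemma card_half_graphs:
  assumes wf: "wf_ugraph G"
  shows "card (half_graphs G) =
    card {F \<in> half_choices G. \<forall>e \<in> edges G. edge_sign G F e = 1}" (is "_ = card ?C")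
proof -
  let ?f = "\<lambda>H. \<lambda>v\<in>verts G. incident H v"
  have "bij_betw ?f (half_graphs G) ?C"
    unfolding bij_betw_def
  proof (intro conjI equalityI subsetI)
    show "inj_on ?f (half_graphs G)"
    proof (rule inj_onI)
      fix H H' assume H: "H \<in> half_graphs G" "H' \<in> half_graphs G" and eq: "?f H = ?f H'"
      have inc: "incident H v = incident H' v" if "v \<in> verts G" for v
        using fun_cong[OF eq, of v] that by simp
      have "e \<in> edges H \<longleftrightarrow> e \<in> edges H'" for e
      proof (cases "e \<in> edges G")
        case True
        then obtain u v where "ends G e = {u, v}" "u \<in> verts G"
          using wf_ends[OF wf] by metis
        with inc[of u] H show ?thesis
          unfolding half_graph_iff incident_def by auto
      next
        case False
        with H show ?thesis unfolding half_graph_iff by auto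
      qed
      with H show "H = H'" unfolding half_graph_iff by (intro ugraph.equality) auto
    qed
  next
    fix F assume "F \<in> ?f ` half_graphs G"
    then obtain H where H: "H \<in> half_graphs G" and F: "F = ?f H" by auto
    have "edge_sign G F e = 1" if e: "e \<in> edges G" for e
    proof -
      obtain u v where uv: "ends G e = {u, v}" "u \<noteq> v" "u \<in> verts G" "v \<in> verts G"
        by (rule wf_ends[OF wf e])
      then show ?thesis
        unfolding edge_sign_doubleton[of G e, OF uv(1,2)]
        using H by (simp add: F incident_def half_graph_iff)
    qed
    moreover have "F \<in> half_choices G"
      unfolding half_choices_def F using H
      by (intro PiE_I) (auto simp: half_graph_iff incident_def)
    ultimately show "F \<in> ?C" by simp
  next
    fix F assume F: "F \<in> ?C"
    then have FC: "F \<in> half_choices G" by simp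
    \<comment> \<open>As the ends of each edge agree, being chosen at some end is the same as being
      chosen at both.\<close>
    define H where "H = G\<lparr>edges := {e \<in> edges G. \<exists>v \<in> ends G e. e \<in> F v}\<rparr>"
    have inc: "incident H v = F v" if v: "v \<in> verts G" for v
    proof (intro equalityI subsetI)
      fix e assume "e \<in> incident H v"
      then obtain w where e: "e \<in> edges G" "v \<in> ends G e" "w \<in> ends G e" "e \<in> F w"
        unfolding H_def incident_def by auto
      obtain x y where xy: "ends G e = {x, y}" "x \<noteq> y"
        by (rule wf_ends[OF wf e(1)])
      have "edge_sign G F e = 1" using F e(1) by simp
      then have "e \<in> F x \<longleftrightarrow> e \<in> F y"
        unfolding edge_sign_doubleton[of G e, OF xy] by (simp split: if_splits)
      then show "e \<in> F v" using e xy by auto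
    next
      fix e assume e: "e \<in> F v"
      have "F v \<subseteq> incident G v"
        by (rule half_choices_D(1)[OF FC v])
      with e show "e \<in> incident H v" unfolding incident_def H_def by auto
    qed
    have "2 * card (F v) = card (incident G v)" if "v \<in> verts G" for v
      by (rule half_choices_D(2)[OF FC that])
    then have "H \<in> half_graphs G"
      unfolding half_graph_iff using inc by (auto simp: H_def)
    moreover have "F = ?f H"
    proof
      fix v
      show "F v = ?f H v"
        using half_choices_D(3)[OF FC] inc[of v] by (cases "v \<in> verts G") simp_all
    qed
    ultimately show "F \<in> ?f ` half_graphs G" by blast
  qed
  then show ?thesis by (rule bij_betw_same_card)
qed

section \<open>Eulerian orientations as local choices\<close>

lemma orientation_ends:
  assumes "d \<in> orientations G" "e \<in> edges G"
  shows "ends G e = {fst (d e), snd (d e)}"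
  using PiE_mem[OF assms(1)[unfolded orientations_def] assms(2)] by (simp add: case_prod_beta)

text \<open>Without loops, in-degree and out-degree add up to the degree, so balance means that the
  outgoing edges are half of the incident ones.\<close>

lemma eulerian_orientation_iff:
  assumes wf: "wf_ugraph G"
  shows "d \<in> eulerian_orientations G \<longleftrightarrow> d \<in> orientations G \<and>
    (\<forall>v \<in> verts G. 2 * card {e \<in> edges G. fst (d e) = v} = card (incident G v))"
proof -
  have "in_degree G d v = out_degree G d v
      \<longleftrightarrow> 2 * card {e \<in> edges G. fst (d e) = v} = card (incident G v)"
    if d: "d \<in> orientations G" for v
  proof -
    have ends: "ends G e = {fst (d e), snd (d e)}" "fst (d e) \<noteq> snd (d e)"
      if "e \<in> edges G" for e
    proof -
      show *: "ends G e = {fst (d e), snd (d e)}"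
        by (rule orientation_ends[OF d that])
      show "fst (d e) \<noteq> snd (d e)"
      proof
        assume "fst (d e) = snd (d e)"
        then have "card (ends G e) = 1" using * by simp
        then show False using wf that unfolding wf_ugraph_def by simp
      qed
    qed
    have "incident G v = {e \<in> edges G. fst (d e) = v} \<union> {e \<in> edges G. snd (d e) = v}"
      using ends(1) unfolding incident_def by auto
    moreover have "finite (edges G)" using wf unfolding wf_ugraph_def by simp
    moreover have "{e \<in> edges G. fst (d e) = v} \<inter> {e \<in> edges G. snd (d e) = v} = {}"
      by (auto dest: ends(2))
    ultimately have "card (incident G v)
        = card {e \<in> edges G. fst (d e) = v} + card {e \<in> edges G. snd (d e) = v}"
      by (simp add: card_Un_disjoint)
    then show ?thesis unfolding in_degree_def out_degree_def by auto
  qed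
  then show ?thesis unfolding eulerian_orientations_def by auto
qed

text \<open>Each vertex chooses its outgoing edges, so an edge is chosen by its tail and not by its
  head; disagreement at the ends is what allows the tail to be recovered.\<close>

lemma card_eulerian_orientations:
  assumes wf: "wf_ugraph G"
  shows "card (eulerian_orientations G) =
    card {F \<in> half_choices G. \<forall>e \<in> edges G. edge_sign G F e = -1}" (is "_ = card ?C")
proof -
  let ?f = "\<lambda>d. \<lambda>v\<in>verts G. {e \<in> edges G. fst (d e) = v}"
  have "bij_betw ?f (eulerian_orientations G) ?C"
    unfolding bij_betw_def
  proof (intro conjI equalityI subsetI)
    show "inj_on ?f (eulerian_orientations G)"
    proof (rule inj_onI)
      fix d d' assume "d \<in> eulerian_orientations G" "d' \<in> eulerian_orientations G"
        and eq: "?f d = ?f d'"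
      then have d: "d \<in> orientations G" "d' \<in> orientations G"
        unfolding eulerian_orientations_def by auto
      show "d = d'"
      proof (rule PiE_ext[OF d[unfolded orientations_def]])
        fix e assume e: "e \<in> edges G"
        have ends: "ends G e = {fst (d e), snd (d e)}" "ends G e = {fst (d' e), snd (d' e)}"
          by (rule orientation_ends[OF d(1) e], rule orientation_ends[OF d(2) e])
        then have "fst (d e) \<in> verts G"
          using wf e unfolding wf_ugraph_def by blast
        \<comment> \<open>Comparing the two families at the tail of \<open>e\<close> under
          \<open>d\<close> shows that \<open>e\<close> has the same tail under \<open>d'\<close>;
          the head is then the other end.\<close>
        then have "{a \<in> edges G. fst (d a) = fst (d e)} = {a \<in> edges G. fst (d' a) = fst (d e)}"
          using fun_cong[OF eq, of "fst (d e)"] by simp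
        then have "e \<in> {a \<in> edges G. fst (d' a) = fst (d e)}" using e by blast
        then have "fst (d e) = fst (d' e)" by simp
        moreover from this have "snd (d e) = snd (d' e)"
          using ends by (auto simp: doubleton_eq_iff)
        ultimately show "d e = d' e" by (rule prod_eqI)
      qed
    qed
  next
    fix F assume "F \<in> ?f ` eulerian_orientations G"
    then obtain d where d: "d \<in> eulerian_orientations G" and F: "F = ?f d" by auto
    from d have "d \<in> orientations G" unfolding eulerian_orientations_def by simp
    note ends = orientation_ends[OF this]
    have "edge_sign G F e = -1" if e: "e \<in> edges G" for e
    proof -
      obtain u v where uv: "ends G e = {u, v}" "u \<noteq> v" "u \<in> verts G" "v \<in> verts G"
        by (rule wf_ends[OF wf e])
      then have "fst (d e) = u \<longleftrightarrow> fst (d e) \<noteq> v"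
        using ends[OF e] by (auto simp: doubleton_eq_iff)
      then show ?thesis
        unfolding edge_sign_doubleton[of G e, OF uv(1,2)] using e uv(3,4) by (simp add: F)
    qed
    moreover have "F \<in> half_choices G"
      unfolding half_choices_def F
    proof (intro PiE_I CollectI conjI)
      fix v assume v: "v \<in> verts G"
      show "(\<lambda>v\<in>verts G. {e \<in> edges G. fst (d e) = v}) v \<subseteq> incident G v"
        using v ends by (auto simp: incident_def)
      show "2 * card ((\<lambda>v\<in>verts G. {e \<in> edges G. fst (d e) = v}) v) = card (incident G v)"
        using v d by (simp add: eulerian_orientation_iff[OF wf])
    qed simp
    ultimately show "F \<in> ?C" by simp
  next
    fix F assume F: "F \<in> ?C"
    then have FC: "F \<in> half_choices G" by simp
    \<comment> \<open>The tail is the end that chose \<open>e\<close>, the head the end that did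
      not.\<close>
    have "\<exists>p. ends G e = {fst p, snd p} \<and> e \<in> F (fst p) \<and> e \<notin> F (snd p)"
      if e: "e \<in> edges G" for e
    proof -
      obtain u v where uv: "ends G e = {u, v}" "u \<noteq> v"
        by (rule wf_ends[OF wf e])
      have "edge_sign G F e = -1" using F e by simp
      then have "e \<in> F u \<longleftrightarrow> e \<notin> F v"
        unfolding edge_sign_doubleton[of G e, OF uv] by (auto split: if_splits)
      then show ?thesis
        using uv(1) by (cases "e \<in> F u")
          (auto intro: exI[of _ "(u, v)"] exI[of _ "(v, u)"])
    qed
    then obtain p where p: "\<And>e. e \<in> edges G \<Longrightarrow>
        ends G e = {fst (p e), snd (p e)} \<and> e \<in> F (fst (p e)) \<and> e \<notin> F (snd (p e))"
      by metis
    define d where "d = restrict p (edges G)"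
    have tails: "{e \<in> edges G. fst (d e) = v} = F v" if v: "v \<in> verts G" for v
    proof (intro equalityI subsetI)
      fix e assume "e \<in> F v"
      moreover have "F v \<subseteq> incident G v"
        by (rule half_choices_D(1)[OF FC v])
      ultimately show "e \<in> {e \<in> edges G. fst (d e) = v}"
        using p[of e] unfolding incident_def d_def by auto
    qed (use p in \<open>auto simp: d_def\<close>)
    have "d \<in> orientations G"
      unfolding orientations_def d_def using p by (intro restrict_PiE_iff[THEN iffD2]) auto
    moreover have "2 * card (F v) = card (incident G v)" if "v \<in> verts G" for v
      by (rule half_choices_D(2)[OF FC that])
    ultimately have "d \<in> eulerian_orientations G"
      unfolding eulerian_orientation_iff[OF wf] using tails by auto
    moreover have "F = ?f d"
    proof
      fix v
      show "F v = ?f d v"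
        using half_choices_D(3)[OF FC] tails[of v] by (cases "v \<in> verts G") simp_all
    qed
    ultimately show "F \<in> ?f ` eulerian_orientations G" by blast
  qed
  then show ?thesis by (rule bij_betw_same_card)
qed

section \<open>Expansion over edge subsets\<close>

text \<open>For \<open>A\<close> a set of edges of a well-formed graph, this is the factored form of
  the sum, over all \<open>half_choices\<close>, of the product of the edge signs on
  \<open>A\<close>.\<close>

definition weight :: "('v, 'e) ugraph \<Rightarrow> 'e set \<Rightarrow> real" where
  "weight G A = (\<Prod>v\<in>verts G. char_sum (incident G v) A)"

text \<open>The product over the ends of an edge extends to all vertices, since \<open>F v\<close>
  contains only edges at \<open>v\<close>; exchanging the two products then counts the signs vertex
  by vertex.\<close>

lemma prod_edge_sign:
  assumes wf: "wf_ugraph G" and A: "A \<subseteq> edges G" and F: "F \<in> half_choices G"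
  shows "(\<Prod>e\<in>A. edge_sign G F e) = (\<Prod>v\<in>verts G. (-1) ^ card (F v \<inter> A))"
proof -
  have fin: "finite (verts G)" "finite A"
    using wf A finite_subset unfolding wf_ugraph_def by auto
  have F_inc: "F v \<subseteq> incident G v" if "v \<in> verts G" for v
    by (rule half_choices_D(1)[OF F that])
  have "(\<Prod>e\<in>A. edge_sign G F e) = (\<Prod>e\<in>A. \<Prod>v\<in>verts G. if e \<in> F v then -1 else 1)"
  proof (rule prod.cong)
    fix e assume "e \<in> A"
    then have "ends G e \<subseteq> verts G" using wf A unfolding wf_ugraph_def by auto
    then show "edge_sign G F e = (\<Prod>v\<in>verts G. if e \<in> F v then -1 else 1)"
      unfolding edge_sign_def using fin F_inc
      by (intro prod.mono_neutral_left) (auto simp: incident_def)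
  qed simp
  also have "\<dots> = (\<Prod>v\<in>verts G. \<Prod>e\<in>A. if e \<in> F v then -1 else 1)"
    by (rule prod.swap)
  also have "\<dots> = (\<Prod>v\<in>verts G. (-1) ^ card (F v \<inter> A))"
    using fin by (intro prod.cong) (auto simp: prod.If_cases Int_def conj_commute)
  finally show ?thesis .
qed

text \<open>A factor \<open>s * edge_sign G F e + 1\<close> is 2 if the sign equals \<open>s\<close>
  and 0 otherwise, so the product over the edges is a scaled indicator, which is expanded over edge
  subsets. The value \<open>s = 1\<close> counts half-graphs and \<open>s = -1\<close> Eulerian
  orientations.\<close>

lemma card_constant_edge_sign:
  assumes wf: "wf_ugraph G" and s: "s = 1 \<or> s = -1"
  shows "2 ^ card (edges G) * real (card {F \<in> half_choices G. \<forall>e \<in> edges G. edge_sign G F e = s})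
    = (\<Sum>A\<in>Pow (edges G). s ^ card A * weight G A)" (is "_ * real (card ?C) = _")
proof -
  have fin: "finite (edges G)" "finite (verts G)" using wf unfolding wf_ugraph_def by auto
  note finC = finite_half_choices[OF wf]
  have sign: "edge_sign G F e = 1 \<or> edge_sign G F e = -1" if "e \<in> edges G" for F e
    by (rule wf_ends[OF wf that]) (simp add: edge_sign_doubleton)
  have "2 ^ card (edges G) * real (card ?C)
      = (\<Sum>F\<in>half_choices G. if F \<in> ?C then 2 ^ card (edges G) else 0)"
    using finC by (simp add: sum.If_cases Int_def)
  also have "\<dots> = (\<Sum>F\<in>half_choices G. \<Prod>e\<in>edges G. s * edge_sign G F e + 1)"
  proof (rule sum.cong)
    fix F assume F: "F \<in> half_choices G"
    show "(if F \<in> ?C then 2 ^ card (edges G) else 0) = (\<Prod>e\<in>edges G. s * edge_sign G F e + 1)"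
    proof (cases "F \<in> ?C")
      case True
      then have "(\<Prod>e\<in>edges G. s * edge_sign G F e + 1) = (\<Prod>e\<in>edges G. 2)"
        using s by (intro prod.cong) auto
      with True show ?thesis by simp
    next
      case False
      then obtain e where e: "e \<in> edges G" "edge_sign G F e \<noteq> s" using F by auto
      then have "s * edge_sign G F e + 1 = 0" using sign[of e F] s by auto
      with e(1) fin(1) have "(\<Prod>e\<in>edges G. s * edge_sign G F e + 1) = 0" by (intro prod_zero) auto
      with False show ?thesis by simp
    qed
  qed simp
  also have "\<dots> = (\<Sum>F\<in>half_choices G. \<Sum>A\<in>Pow (edges G). s ^ card A * (\<Prod>e\<in>A. edge_sign G F e))"
    using fin by (simp add: prod_add prod.distrib)
  also have "\<dots> = (\<Sum>A\<in>Pow (edges G). \<Sum>F\<in>half_choices G. s ^ card A * (\<Prod>e\<in>A. edge_sign G F e))"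
    by (rule sum.swap)
  also have "\<dots> = (\<Sum>A\<in>Pow (edges G). s ^ card A * weight G A)"
  proof (rule sum.cong)
    fix A assume "A \<in> Pow (edges G)"
    then have A: "A \<subseteq> edges G" by simp
    have "(\<Sum>F\<in>half_choices G. \<Prod>e\<in>A. edge_sign G F e)
        = (\<Sum>F\<in>half_choices G. \<Prod>v\<in>verts G. (-1) ^ card (F v \<inter> A))"
      using prod_edge_sign[OF wf A] by (intro sum.cong) auto
    \<comment> \<open>Independence of the local choices turns the sum of products into a product of
      character sums.\<close>
    also have "\<dots> = weight G A"
      unfolding weight_def char_sum_def half_choices_def
      by (rule prod_sum_PiE[symmetric]) (use fin finite_incident[OF wf] in auto)
    finally show "(\<Sum>F\<in>half_choices G. s ^ card A * (\<Prod>e\<in>A. edge_sign G F e))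
        = s ^ card A * weight G A"
      by (simp add: sum_distrib_left[symmetric])
  qed simp
  finally show ?thesis .
qed

section \<open>Vanishing and sign of the weights\<close>

lemma weight_eq_0:
  assumes "wf_ugraph G" "v \<in> verts G" "odd (card (incident G v \<inter> A))"
  shows "weight G A = 0"
proof -
  have "char_sum (incident G v) A = 0"
    by (rule char_sum_odd[OF finite_incident[OF assms(1)] assms(3)])
  moreover have "finite (verts G)" using assms(1) unfolding wf_ugraph_def by simp
  ultimately show ?thesis
    unfolding weight_def using assms(2) by (intro prod_zero) auto
qed

text \<open>By double counting the halved degrees of \<open>A\<close> sum to \<open>card A\<close>,
  so the sign splits over the vertices and makes each factor positive by
  \<open>char_sum_even\<close>.\<close>

lemma weight_sign:
  assumes "eulerian G" and A: "A \<subseteq> edges G"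
    and even: "\<And>v. v \<in> verts G \<Longrightarrow> even (card (incident G v \<inter> A))"
  shows "(-1) ^ card A * weight G A > 0"
proof -
  have wf: "wf_ugraph G"
    and deg: "\<And>v. v \<in> verts G \<Longrightarrow> even (card (incident G v))"
    using assms(1) unfolding eulerian_def Defs.degree_def incident_def by auto
  have "2 * (\<Sum>v\<in>verts G. card (incident G v \<inter> A) div 2) = (\<Sum>v\<in>verts G. card (incident G v \<inter> A))"
    using even by (simp add: sum_distrib_left)
  also have "\<dots> = (\<Sum>e\<in>A. card (ends G e \<inter> verts G))"
    using sum_card_incident[OF wf A] by simp
  also have "\<dots> = (\<Sum>e\<in>A. 2)"
    using wf A unfolding wf_ugraph_def by (intro sum.cong) (auto simp: Int_absorb2 subset_iff)
  finally have "(\<Sum>v\<in>verts G. card (incident G v \<inter> A) div 2) = card A" by simp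
  then have "(-1) ^ card A * weight G A
      = (\<Prod>v\<in>verts G. (-1) ^ (card (incident G v \<inter> A) div 2) * char_sum (incident G v) A)"
    unfolding weight_def prod.distrib by (simp flip: power_sum)
  also have "\<dots> > 0"
    by (intro prod_pos char_sum_even finite_incident[OF wf] deg even)
  finally show ?thesis .
qed

section \<open>Comparison of the two counts\<close>

theorem theorem1p4:
  fixes G :: "('v, 'e) ugraph"
  assumes "eulerian G"
  shows "card (eulerian_orientations G) \<ge> card (half_graphs G) \<and>
    (card (eulerian_orientations G) = card (half_graphs G) \<longleftrightarrow> bipartite G)"
proof -
  have wf: "wf_ugraph G" using assms unfolding eulerian_def by simp
  then have fin: "finite (edges G)" unfolding wf_ugraph_def by simp
  \<comment> \<open>The coefficient is 0 for sets of even size and -2 for sets of odd size.\<close>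
  define excess where "excess A = ((-1) ^ card A - 1) * weight G A" for A
  have "2 ^ card (edges G) * (real (card (eulerian_orientations G)) - card (half_graphs G))
      = (\<Sum>A\<in>Pow (edges G). (-1) ^ card A * weight G A) - (\<Sum>A\<in>Pow (edges G). 1 ^ card A * weight G A)"
    unfolding card_eulerian_orientations[OF wf] card_half_graphs[OF wf] right_diff_distrib
    by (simp only: card_constant_edge_sign[OF wf] simp_thms)
  also have "\<dots> = sum excess (Pow (edges G))"
    unfolding excess_def by (simp add: sum_subtractf left_diff_distrib)
  finally have diff: "2 ^ card (edges G) *
      (real (card (eulerian_orientations G)) - card (half_graphs G)) = sum excess (Pow (edges G))" .
  have pos: "excess A > 0" if "A \<subseteq> edges G" "\<forall>v \<in> verts G. even (card (incident G v \<inter> A))"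
    "odd (card A)" for A
    using weight_sign[OF assms that(1)] that(2,3) unfolding excess_def by simp
  have zero: "excess A = 0" if "\<not> (\<forall>v \<in> verts G. even (card (incident G v \<inter> A))) \<or> even (card A)" for A
    using weight_eq_0[OF wf] that unfolding excess_def by auto
  have nonneg: "excess A \<ge> 0" if "A \<in> Pow (edges G)" for A
    using pos[of A] zero[of A] that by force
  \<comment> \<open>A sum of nonnegative terms vanishes only termwise, so equality excludes every
    odd set with all degrees even, which is the parity criterion for bipartiteness.\<close>
  have "sum excess (Pow (edges G)) = 0 \<longleftrightarrow> (\<forall>A\<in>Pow (edges G). excess A = 0)"
    using fin nonneg by (intro sum_nonneg_eq_0_iff) auto
  also have "\<dots> \<longleftrightarrow> bipartite G"
    unfolding bipartite_iff_no_odd_even_subgraph[OF wf] using pos zero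
    by (metis PowD PowI less_irrefl)
  finally have "sum excess (Pow (edges G)) = 0 \<longleftrightarrow> bipartite G" .
  moreover have "sum excess (Pow (edges G)) \<ge> 0"
    using nonneg by (rule sum_nonneg)
  ultimately show ?thesis
    unfolding diff[symmetric] by (auto simp: zero_le_mult_iff power_le_zero_eq)
qed

end
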